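(* Let $G$ be a group and let $A$ be a subset of $G$. The following statements are equivalent: (i) $A$ is disparse, that is, for every $p\in G^*$ the set $\Delta_p(A)$ is discrete (as a subspace of $\beta G$); (ii) if $p\in A^*$ then $p\notin G^*p$.
   Context: $G$ is a discrete group. $\beta G$ is the Stone-Čech compactification of $G$, whose points are the ultrafilters on $G$ (points of $G$ being identified with principal ultrafilters), with base of open sets $\overline{A}=\{p\in\beta G: A\in p\}$, $A\subseteq G$. $G^*=\beta G\setminus G$ is the set of free ultrafilters on $G$, and $A^*=\overline{A}\cap G^*$ for $A\subseteq G$. $\beta G$ is a semigroup under the product defined by: for $A\subseteq G$, $A\in pq$ if and only if $\{g\in G: g^{-1}A\in q\}\in p$. For $p\in\beta G$, $Gp=\{gp:g\in G\}$ and $G^*p=\{qp:q\in G^*\}$. For $A\subseteq G$ and $p\in G^*$, the $p$-companion of $A$ is $\Delta_p(A)=A^*\cap Gp=\{gp: g\in G,\ A\in gp\}$. *)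

theory Defs
  imports "HOL-Analysis.Abstract_Topology" "HOL-Algebra.Coset"
begin

definition ultrafilter_on :: "'a set \<Rightarrow> 'a set set \<Rightarrow> bool" where
  "ultrafilter_on X p \<longleftrightarrow>
     p \<subseteq> Pow X \<and> X \<in> p \<and> {} \<notin> p \<and>
     (\<forall>A\<in>p. \<forall>B\<in>p. A \<inter> B \<in> p) \<and>
     (\<forall>A\<in>p. \<forall>B. A \<subseteq> B \<and> B \<subseteq> X \<longrightarrow> B \<in> p) \<and>
     (\<forall>A. A \<subseteq> X \<longrightarrow> A \<in> p \<or> X - A \<in> p)"

definition principal_uf :: "'a set \<Rightarrow> 'a \<Rightarrow> 'a set set" where
  "principal_uf X x = {A. A \<subseteq> X \<and> x \<in> A}"

definition beta :: "('a, 'm) monoid_scheme \<Rightarrow> 'a set set set" where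
  "beta G = {p. ultrafilter_on (carrier G) p}"

definition beta_basic :: "('a, 'm) monoid_scheme \<Rightarrow> 'a set \<Rightarrow> 'a set set set" where
  "beta_basic G A = {p \<in> beta G. A \<in> p}"

text \<open>The generating family is closed under finite intersections, so it is a base of the topology
  and not merely a subbase; see \<open>openin_beta_topology_iff\<close> below.\<close>

definition beta_topology :: "('a, 'm) monoid_scheme \<Rightarrow> 'a set set topology" where
  "beta_topology G = topology_generated_by {beta_basic G A |A. A \<subseteq> carrier G}"

definition free_ufs :: "('a, 'm) monoid_scheme \<Rightarrow> 'a set set set" where
  "free_ufs G = beta G - principal_uf (carrier G) ` carrier G"

definition star :: "('a, 'm) monoid_scheme \<Rightarrow> 'a set \<Rightarrow> 'a set set set" where
  "star G A = beta_basic G A \<inter> free_ufs G"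

definition uf_prod :: "('a, 'm) monoid_scheme \<Rightarrow> 'a set set \<Rightarrow> 'a set set \<Rightarrow> 'a set set" where
  "uf_prod G p q =
     {A. A \<subseteq> carrier G \<and> {g \<in> carrier G. (inv\<^bsub>G\<^esub> g) <#\<^bsub>G\<^esub> A \<in> q} \<in> p}"

text \<open>The orbit \<open>Gp\<close>, with each \<open>g\<close> in \<open>G\<close> identified with its principal ultrafilter.\<close>

definition uf_orbit :: "('a, 'm) monoid_scheme \<Rightarrow> 'a set set \<Rightarrow> 'a set set set" where
  "uf_orbit G p = (\<lambda>g. uf_prod G (principal_uf (carrier G) g) p) ` carrier G"

definition free_orbit :: "('a, 'm) monoid_scheme \<Rightarrow> 'a set set \<Rightarrow> 'a set set set" where
  "free_orbit G p = (\<lambda>q. uf_prod G q p) ` free_ufs G"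

definition companion :: "('a, 'm) monoid_scheme \<Rightarrow> 'a set set \<Rightarrow> 'a set \<Rightarrow> 'a set set set" where
  "companion G p A = star G A \<inter> uf_orbit G p"

definition disparse :: "('a, 'm) monoid_scheme \<Rightarrow> 'a set \<Rightarrow> bool" where
  "disparse G A \<longleftrightarrow>
     (\<forall>p \<in> free_ufs G.
        subtopology (beta_topology G) (companion G p A) = discrete_topology (companion G p A))"

lemma beta_basic_Int:
  assumes "A \<subseteq> carrier G" "B \<subseteq> carrier G"
  shows "beta_basic G A \<inter> beta_basic G B = beta_basic G (A \<inter> B)"
proof -
  have "A \<in> p \<and> B \<in> p \<longleftrightarrow> A \<inter> B \<in> p" if "ultrafilter_on (carrier G) p" for p
    using that assms unfolding ultrafilter_on_def by (meson Int_lower1 Int_lower2)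
  then show ?thesis
    by (auto simp: beta_basic_def beta_def)
qed

lemma openin_beta_topology_iff:
  "openin (beta_topology G) U \<longleftrightarrow>
     U \<subseteq> beta G \<and> (\<forall>p\<in>U. \<exists>A. A \<subseteq> carrier G \<and> p \<in> beta_basic G A \<and> beta_basic G A \<subseteq> U)"
  (is "_ \<longleftrightarrow> ?R U")
proof
  assume "openin (beta_topology G) U"
  then have "generate_topology_on {beta_basic G A |A. A \<subseteq> carrier G} U"
    by (simp add: beta_topology_def openin_topology_generated_by_iff)
  then show "?R U"
  proof induction
    case Empty
    then show ?case by simp
  next
    case (Int U V)
    have "\<exists>A. A \<subseteq> carrier G \<and> p \<in> beta_basic G A \<and> beta_basic G A \<subseteq> U \<inter> V"
      if p: "p \<in> U \<inter> V" for p
    proof -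
      obtain A B where "A \<subseteq> carrier G" "p \<in> beta_basic G A" "beta_basic G A \<subseteq> U"
        "B \<subseteq> carrier G" "p \<in> beta_basic G B" "beta_basic G B \<subseteq> V"
        using Int.IH p by (meson IntD1 IntD2)
      then show ?thesis
        using beta_basic_Int[of A G B] by (intro exI[of _ "A \<inter> B"]) blast
    qed
    then show ?case using Int.IH by blast
  next
    case (UN K)
    then show ?case by (meson Sup_least Union_iff Union_upper subset_trans)
  next
    case (Basis s)
    then show ?case by (auto simp: beta_basic_def)
  qed
next
  assume R: "?R U"
  have "U = \<Union>{beta_basic G A |A. A \<subseteq> carrier G \<and> beta_basic G A \<subseteq> U}"
    using R by blast
  moreover have "openin (beta_topology G) \<dots>"
    by (rule openin_Union) (auto simp: beta_topology_def intro!: topology_generated_by_Basis)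
  ultimately show "openin (beta_topology G) U" by simp
qed

lemma topspace_beta_topology: "topspace (beta_topology G) = beta G"
proof -
  have "p \<in> beta_basic G (carrier G)" if "p \<in> beta G" for p
    using that by (auto simp: beta_basic_def beta_def ultrafilter_on_def)
  then show ?thesis
    unfolding beta_topology_def topology_generated_by_topspace by (auto simp: beta_basic_def)
qed

end

theory Submission
  imports Defs
begin

text \<open>Membership in products of ultrafilters describes returns: by definition, \<open>p = qp\<close> says that
  for every \<open>U \<in> p\<close> the set \<open>{h. U \<in> hp}\<close> of elements that move \<open>p\<close> into the basic neighbourhood
  given by \<open>U\<close> belongs to \<open>q\<close>; in other words, \<open>hp\<close> converges to \<open>p\<close> along \<open>q\<close>. So a solution
  \<open>p \<in> A\<^sup>*\<close> of \<open>p \<in> G\<^sup>*p\<close> should be the same as an accumulation point of a companion \<open>\<Delta>\<^sub>p(A)\<close>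
  that belongs to it. Each direction has one difficulty: that the returning translates differ from
  the point, respectively that the limit can be taken along a free ultrafilter.

  If \<open>p = qp\<close> with \<open>q\<close> free, every neighbourhood of \<open>p\<close> contains \<open>hp\<close> for \<open>q\<close>-many, hence for some
  \<open>h \<noteq> 1\<close>, and these points also lie in \<open>A\<^sup>*\<close> because \<open>A \<in> p\<close>. They are genuinely different from
  \<open>p\<close> because \<open>G\<close> acts freely on \<open>\<beta>G\<close> (\<open>uf_translate_neq\<close>), which rests on cutting a fixed-point-free
  map into pieces disjoint from their images (\<open>fixed_point_free_decomposition\<close>).

  Conversely, if \<open>q \<in> \<Delta>\<^sub>p(A)\<close> is not isolated, the sets \<open>{h. U \<in> hq \<and> hq \<noteq> q}\<close>, for \<open>U \<in> q\<close>, are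
  nonempty, since \<open>Gp = Gq\<close>, and closed under intersection. Any ultrafilter \<open>r\<close> containing all of them satisfies
  \<open>q = rq\<close>, and \<open>r\<close> cannot be the principal ultrafilter of an \<open>h\<close>, since then both
  \<open>hq = q\<close> and \<open>hq \<noteq> q\<close>.\<close>

section \<open>Ultrafilters\<close>

lemma ultrafilter_onD:
  assumes "ultrafilter_on X p"
  shows ultrafilter_on_subset: "A \<in> p \<Longrightarrow> A \<subseteq> X"
    and ultrafilter_on_UNIV: "X \<in> p"
    and ultrafilter_on_empty: "{} \<notin> p"
    and ultrafilter_on_Int: "A \<in> p \<Longrightarrow> B \<in> p \<Longrightarrow> A \<inter> B \<in> p"
    and ultrafilter_on_mono: "A \<in> p \<Longrightarrow> A \<subseteq> B \<Longrightarrow> B \<subseteq> X \<Longrightarrow> B \<in> p"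
    and ultrafilter_on_cases: "A \<subseteq> X \<Longrightarrow> A \<in> p \<or> X - A \<in> p"
proof -
  have u: "p \<subseteq> Pow X" "X \<in> p" "{} \<notin> p" "\<forall>A\<in>p. \<forall>B\<in>p. A \<inter> B \<in> p"
      "\<forall>A\<in>p. \<forall>B. A \<subseteq> B \<and> B \<subseteq> X \<longrightarrow> B \<in> p" "\<forall>A. A \<subseteq> X \<longrightarrow> A \<in> p \<or> X - A \<in> p"
    using assms unfolding ultrafilter_on_def by simp_all
  show "A \<in> p \<Longrightarrow> A \<subseteq> X"
    using u(1) by (rule PowD[OF subsetD])
  show "X \<in> p" "{} \<notin> p"
    by (rule u)+
  show "A \<in> p \<Longrightarrow> B \<in> p \<Longrightarrow> A \<inter> B \<in> p"
    by (rule u(4)[rule_format])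
  show "A \<in> p \<Longrightarrow> A \<subseteq> B \<Longrightarrow> B \<subseteq> X \<Longrightarrow> B \<in> p"
    by (rule u(5)[rule_format, OF _ conjI])
  show "A \<subseteq> X \<Longrightarrow> A \<in> p \<or> X - A \<in> p"
    by (rule u(6)[rule_format])
qed

lemma ultrafilter_on_Diff_iff:
  assumes "ultrafilter_on X p" "A \<subseteq> X"
  shows "X - A \<in> p \<longleftrightarrow> A \<notin> p"
proof
  show "A \<notin> p" if "X - A \<in> p"
    using ultrafilter_on_Int[OF assms(1) that, of A] ultrafilter_on_empty[OF assms(1)]
    by (auto simp: Int_commute)
  show "X - A \<in> p" if "A \<notin> p"
    using that ultrafilter_on_cases[OF assms] by blast
qed

lemma ultrafilter_on_subset_eq:
  assumes p: "ultrafilter_on X p" and q: "ultrafilter_on X q" and "p \<subseteq> q"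
  shows "p = q"
proof -
  have "A \<in> p" if "A \<in> q" for A
  proof -
    have "A \<subseteq> X" "X - A \<notin> q"
      using that ultrafilter_on_subset[OF q] ultrafilter_on_Diff_iff[OF q] by blast+
    with \<open>p \<subseteq> q\<close> show ?thesis
      using ultrafilter_on_Diff_iff[OF p] by blast
  qed
  with \<open>p \<subseteq> q\<close> show ?thesis by blast
qed

lemma principal_if_singleton_mem:
  assumes p: "ultrafilter_on X p" and x: "{x} \<in> p"
  shows "p = principal_uf X x"
proof
  show "p \<subseteq> principal_uf X x"
  proof
    fix A assume A: "A \<in> p"
    then have "A \<inter> {x} \<noteq> {}"
      using ultrafilter_on_Int[OF p _ x] ultrafilter_on_empty[OF p] by force
    with A show "A \<in> principal_uf X x"
      using ultrafilter_on_subset[OF p] by (auto simp: principal_uf_def)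
  qed
  show "principal_uf X x \<subseteq> p"
    using ultrafilter_on_mono[OF p x] by (auto simp: principal_uf_def)
qed

text \<open>Pulling back along a Boolean homomorphism; both translates and products of ultrafilters arise in
  this way.\<close>

lemma ultrafilter_on_pullback:
  assumes p: "ultrafilter_on Y p"
    and full: "v X = Y"
    and Int: "\<And>A B. A \<subseteq> X \<Longrightarrow> B \<subseteq> X \<Longrightarrow> v (A \<inter> B) = v A \<inter> v B"
    and Diff: "\<And>A. A \<subseteq> X \<Longrightarrow> v (X - A) = Y - v A"
  shows "ultrafilter_on X {A. A \<subseteq> X \<and> v A \<in> p}" (is "ultrafilter_on X ?q")
proof -
  have empty: "v {} = {}"
    using Diff[of X] full by simp
  have sub: "v A \<subseteq> Y" if "A \<subseteq> X" for A
    using Int[of A X] that full by (metis Int_absorb2 Int_lower2 order_refl)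
  have mono: "v A \<subseteq> v B" if "A \<subseteq> B" "B \<subseteq> X" for A B
    using Int[of A B] that by (metis Int_absorb2 Int_lower2 order_trans)
  show ?thesis
    unfolding ultrafilter_on_def
  proof (intro conjI ballI allI impI)
    show "?q \<subseteq> Pow X"
      by blast
    show "X \<in> ?q" "{} \<notin> ?q"
      using full empty ultrafilter_onD[OF p] by simp_all
    show "A \<inter> B \<in> ?q" if "A \<in> ?q" "B \<in> ?q" for A B
      using that Int[of A B] ultrafilter_on_Int[OF p] by auto
    show "B \<in> ?q" if "A \<in> ?q" "A \<subseteq> B \<and> B \<subseteq> X" for A B
      using that ultrafilter_on_mono[OF p _ mono[of A B] sub] by blast
    show "A \<in> ?q \<or> X - A \<in> ?q" if "A \<subseteq> X" for A
      using that Diff ultrafilter_on_cases[OF p sub] by auto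
  qed
qed

text \<open>The ultrafilter is a maximal \<open>\<inter>\<close>-closed family of nonempty sets. By maximality it contains
  every set that meets all of its members, and this single property gives upward closure as well as
  the decision between a set and its complement.\<close>

lemma ultrafilter_on_extending:
  assumes sub: "B \<subseteq> Pow X" and ne: "{} \<notin> B" and "B \<noteq> {}"
    and Int: "\<And>S T. S \<in> B \<Longrightarrow> T \<in> B \<Longrightarrow> S \<inter> T \<in> B"
  obtains r where "ultrafilter_on X r" "B \<subseteq> r"
proof -
  define \<F> where "\<F> = {F. B \<subseteq> F \<and> F \<subseteq> Pow X \<and> {} \<notin> F \<and> (\<forall>S\<in>F. \<forall>T\<in>F. S \<inter> T \<in> F)}"
  have "\<exists>M\<in>\<F>. \<forall>F\<in>\<F>. M \<subseteq> F \<longrightarrow> F = M"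
  proof (rule subset_Zorn_nonempty)
    have "B \<in> \<F>"
      using assms by (simp add: \<F>_def)
    then show "\<F> \<noteq> {}"
      by blast
  next
    fix C assume C: "C \<noteq> {}" "subset.chain \<F> C"
    have "S \<inter> T \<in> \<Union>C" if ST: "S \<in> \<Union>C" "T \<in> \<Union>C" for S T
    proof -
      obtain F F' where F: "F \<in> C" "S \<in> F" "F' \<in> C" "T \<in> F'"
        using ST by blast
      then have "F \<subseteq> F' \<or> F' \<subseteq> F"
        using C(2) by (auto simp: subset_chain_def)
      then obtain F'' where "F'' \<in> C" "S \<in> F''" "T \<in> F''"
        using F by blast
      then show ?thesis
        using C(2) by (auto simp: subset_chain_def \<F>_def)
    qed
    moreover have "B \<subseteq> F" "F \<subseteq> Pow X" "{} \<notin> F" if "F \<in> C" for F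
    proof -
      have "F \<in> \<F>"
        using C(2) that by (auto simp: subset_chain_def)
      then show "B \<subseteq> F" "F \<subseteq> Pow X" "{} \<notin> F"
        by (simp_all add: \<F>_def)
    qed
    then have "B \<subseteq> \<Union>C" "\<Union>C \<subseteq> Pow X" "{} \<notin> \<Union>C"
      using C(1) by blast+
    ultimately show "\<Union>C \<in> \<F>"
      by (simp add: \<F>_def)
  qed
  then obtain M where M: "M \<in> \<F>" and max: "\<And>F. F \<in> \<F> \<Longrightarrow> M \<subseteq> F \<Longrightarrow> F = M"
    by blast
  have M_sub: "S \<subseteq> X" if "S \<in> M" for S
    using M that by (auto simp: \<F>_def)
  have M_ne: "{} \<notin> M" and M_Int: "S \<in> M \<Longrightarrow> T \<in> M \<Longrightarrow> S \<inter> T \<in> M" and BM: "B \<subseteq> M" for S T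
    using M by (auto simp: \<F>_def)
  have M_meets: "S \<in> M" if S: "S \<subseteq> X" and meets: "\<And>T. T \<in> M \<Longrightarrow> S \<inter> T \<noteq> {}" for S
  proof -
    \<comment> \<open>The extra \<open>X\<close> puts \<open>S\<close> itself into the enlarged family.\<close>
    let ?F = "M \<union> (\<inter>) S ` insert X M"
    have X_Int: "T \<inter> X = T" "X \<inter> T = T" if "T \<in> M" for T
      using M_sub[OF that] by blast+
    have "P \<inter> Q \<in> ?F" if P: "P \<in> ?F" and Q: "Q \<in> ?F" for P Q
    proof -
      have closed: "T \<inter> T' \<in> insert X M" if "T \<in> insert X M" "T' \<in> insert X M" for T T'
        using that M_Int X_Int by (metis Int_absorb insert_iff)
      have mem: "S \<inter> (T \<inter> T') \<in> ?F" if "T \<in> insert X M" "T' \<in> insert X M" for T T'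
        using closed[OF that] by (intro UnI2 imageI)
      obtain P' where P': "P \<in> M \<and> P' = P \<or> P = S \<inter> P'" "P' \<in> insert X M"
        using P by auto
      obtain Q' where Q': "Q \<in> M \<and> Q' = Q \<or> Q = S \<inter> Q'" "Q' \<in> insert X M"
        using Q by auto
      show ?thesis
      proof (cases "P \<in> M \<and> Q \<in> M")
        case True
        then show ?thesis using M_Int by simp
      next
        case False
        then have "P \<inter> Q = S \<inter> (P' \<inter> Q')"
          using P'(1) Q'(1) by auto
        then show ?thesis using mem[OF P'(2) Q'(2)] by simp
      qed
    qed
    moreover have "{} \<notin> ?F"
    proof -
      obtain T where "T \<in> M"
        using BM \<open>B \<noteq> {}\<close> by blast
      then have "S \<inter> X \<noteq> {}"
        using meets[of T] M_sub[of T] by blast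
      with meets have "S \<inter> T' \<noteq> {}" if "T' \<in> insert X M" for T'
        using that by blast
      then show ?thesis
        using M_ne by (metis UnE imageE)
    qed
    moreover have "B \<subseteq> ?F" "?F \<subseteq> Pow X"
      using BM M_sub S by blast+
    ultimately have "?F \<in> \<F>"
      by (simp add: \<F>_def)
    then have "?F = M"
      by (rule max) (rule Un_upper1)
    moreover have "S \<inter> X \<in> ?F"
      by (intro UnI2 imageI insertI1)
    ultimately show ?thesis
      using S by (simp only: Int_absorb2)
  qed
  have "ultrafilter_on X M"
    unfolding ultrafilter_on_def
  proof (intro conjI ballI allI impI)
    show "M \<subseteq> Pow X"
      using M_sub by blast
    show "{} \<notin> M" "\<And>S T. S \<in> M \<Longrightarrow> T \<in> M \<Longrightarrow> S \<inter> T \<in> M"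
      by (fact M_ne M_Int)+
    have "X \<inter> T \<noteq> {}" if "T \<in> M" for T
      using Int_absorb1[OF M_sub[OF that]] M_ne that by metis
    then show "X \<in> M"
      using M_meets[of X] by blast
    show "T \<in> M" if "S \<in> M" "S \<subseteq> T \<and> T \<subseteq> X" for S T
    proof (rule M_meets)
      show "T \<inter> R \<noteq> {}" if "R \<in> M" for R
      proof -
        have "S \<inter> R \<noteq> {}"
          using M_Int[OF \<open>S \<in> M\<close> \<open>R \<in> M\<close>] M_ne by metis
        then show ?thesis
          using \<open>S \<subseteq> T \<and> T \<subseteq> X\<close> by blast
      qed
    qed (use that in blast)
    show "S \<in> M \<or> X - S \<in> M" if "S \<subseteq> X" for S
    proof (rule disjCI)
      assume "X - S \<notin> M"
      then obtain T where T: "T \<in> M" "(X - S) \<inter> T = {}"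
        using M_meets[of "X - S"] by blast
      then have "T \<subseteq> S"
        using M_sub by blast
      show "S \<in> M"
      proof (rule M_meets)
        show "S \<inter> R \<noteq> {}" if "R \<in> M" for R
        proof -
          have "T \<inter> R \<noteq> {}"
            using M_Int[OF \<open>T \<in> M\<close> that] M_ne by metis
          then show ?thesis
            using \<open>T \<subseteq> S\<close> by blast
        qed
      qed fact
    qed
  qed
  with BM that show thesis by blast
qed

section \<open>The action of a group on its ultrafilters\<close>

text \<open>Take \<open>B\<close> maximal among the sets disjoint from their image. A point \<open>x\<close> outside \<open>B\<close> cannot be
  added to \<open>B\<close>, and since \<open>f x \<noteq> x\<close> this can only be because \<open>f x \<in> B\<close> or \<open>x \<in> f ` B\<close>.\<close>

lemma fixed_point_free_decomposition:
  assumes "\<And>x. x \<in> X \<Longrightarrow> f x \<noteq> x"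
  obtains B where "B \<subseteq> X" "B \<inter> f ` B = {}" "\<And>x. x \<in> X \<Longrightarrow> x \<in> B \<or> f x \<in> B \<or> x \<in> f ` B"
proof -
  let ?\<F> = "{B. B \<subseteq> X \<and> B \<inter> f ` B = {}}"
  have "\<exists>M\<in>?\<F>. \<forall>F\<in>?\<F>. M \<subseteq> F \<longrightarrow> F = M"
  proof (rule subset_Zorn')
    fix C assume C: "subset.chain ?\<F> C"
    have "False" if xy: "x \<in> \<Union>C" "y \<in> \<Union>C" and "f x = y" for x y
    proof -
      obtain F F' where F: "F \<in> C" "x \<in> F" "F' \<in> C" "y \<in> F'"
        using xy by blast
      then have "F \<subseteq> F' \<or> F' \<subseteq> F"
        using C by (auto simp: subset_chain_def)
      then obtain F'' where "F'' \<in> C" "x \<in> F''" "y \<in> F''"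
        using F by blast
      then show ?thesis
        using C \<open>f x = y\<close> by (auto simp: subset_chain_def)
    qed
    moreover have "\<Union>C \<subseteq> X"
      using C by (auto simp: subset_chain_def)
    ultimately show "\<Union>C \<in> ?\<F>" by blast
  qed
  then obtain B where "B \<in> ?\<F>" and max: "\<forall>F\<in>?\<F>. B \<subseteq> F \<longrightarrow> F = B"
    by (rule bexE)
  then have B: "B \<subseteq> X" "B \<inter> f ` B = {}"
    by simp_all
  have "x \<in> B \<or> f x \<in> B \<or> x \<in> f ` B" if "x \<in> X" for x
  proof (rule ccontr)
    assume *: "\<not> (x \<in> B \<or> f x \<in> B \<or> x \<in> f ` B)"
    with B(2) have "insert x B \<inter> f ` insert x B = {}"
      using assms[OF \<open>x \<in> X\<close>] by auto
    then have "insert x B = B"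
      using max B(1) \<open>x \<in> X\<close> by (simp add: subset_insertI)
    with * show False by blast
  qed
  with B that show thesis by blast
qed

abbreviation uf_translate :: "('a, 'm) monoid_scheme \<Rightarrow> 'a \<Rightarrow> 'a set set \<Rightarrow> 'a set set" where
  "uf_translate G g p \<equiv> uf_prod G (principal_uf (carrier G) g) p"

lemma free_ufs_iff:
  "p \<in> free_ufs G \<longleftrightarrow> ultrafilter_on (carrier G) p \<and> (\<forall>x \<in> carrier G. {x} \<notin> p)"
proof -
  have "\<not> (\<exists>x \<in> carrier G. {x} \<in> p)" if "p \<in> free_ufs G"
    using that principal_if_singleton_mem[of "carrier G" p]
    by (auto simp: free_ufs_def beta_def)
  moreover have "{x} \<in> principal_uf (carrier G) x" if "x \<in> carrier G" for x
    using that by (simp add: principal_uf_def)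
  ultimately show ?thesis
    by (auto simp: free_ufs_def beta_def)
qed

context group
begin

lemma inv_l_coset_eq_vimage:
  assumes "g \<in> carrier G" "A \<subseteq> carrier G"
  shows "inv g <# A = {x \<in> carrier G. g \<otimes> x \<in> A}"
proof -
  have "x = inv g \<otimes> (g \<otimes> x)" if "x \<in> carrier G" for x
    using that assms by (simp add: m_assoc[symmetric])
  moreover have "g \<otimes> (inv g \<otimes> a) = a" if "a \<in> A" for a
    using that assms by (simp add: m_assoc[symmetric] subsetD)
  ultimately show ?thesis
    using assms by (auto simp: l_coset_def)
qed

lemma uf_translate_iff:
  assumes "g \<in> carrier G"
  shows "A \<in> uf_translate G g p \<longleftrightarrow> A \<subseteq> carrier G \<and> {x \<in> carrier G. g \<otimes> x \<in> A} \<in> p"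
  using assms by (auto simp: uf_prod_def principal_uf_def inv_l_coset_eq_vimage)

text \<open>The description of \<open>qp\<close> as the limit of \<open>gp\<close> along \<open>q\<close>.\<close>

lemma uf_prod_iff:
  "A \<in> uf_prod G q p \<longleftrightarrow>
     A \<subseteq> carrier G \<and> {g \<in> carrier G. A \<in> uf_translate G g p} \<in> q"
proof (cases "A \<subseteq> carrier G")
  case True
  then have "{g \<in> carrier G. inv g <# A \<in> p} = {g \<in> carrier G. A \<in> uf_translate G g p}"
    by (auto simp: uf_translate_iff inv_l_coset_eq_vimage)
  with True show ?thesis
    by (simp add: uf_prod_def)
qed (simp add: uf_prod_def)

lemma ultrafilter_on_translate:
  assumes g: "g \<in> carrier G" and p: "ultrafilter_on (carrier G) p"
  shows "ultrafilter_on (carrier G) (uf_translate G g p)"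
proof -
  have "uf_translate G g p = {A. A \<subseteq> carrier G \<and> {x \<in> carrier G. g \<otimes> x \<in> A} \<in> p}"
    by (simp add: set_eq_iff uf_translate_iff[OF g])
  moreover have "ultrafilter_on (carrier G) \<dots>"
    by (rule ultrafilter_on_pullback[OF p]) (use g in auto)
  ultimately show ?thesis by simp
qed

lemma ultrafilter_on_uf_prod:
  assumes q: "ultrafilter_on (carrier G) q" and p: "ultrafilter_on (carrier G) p"
  shows "ultrafilter_on (carrier G) (uf_prod G q p)"
proof -
  note tr = ultrafilter_on_translate[OF _ p]
  let ?v = "\<lambda>A. {g \<in> carrier G. A \<in> uf_translate G g p}"
  have "uf_prod G q p = {A. A \<subseteq> carrier G \<and> ?v A \<in> q}"
    unfolding set_eq_iff mem_Collect_eq by (intro allI uf_prod_iff)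
  moreover have "ultrafilter_on (carrier G) {A. A \<subseteq> carrier G \<and> ?v A \<in> q}"
  proof (rule ultrafilter_on_pullback[OF q])
    show "?v (carrier G) = carrier G"
      using ultrafilter_on_UNIV[OF tr] by blast
    show "?v (A \<inter> B) = ?v A \<inter> ?v B" if "A \<subseteq> carrier G" "B \<subseteq> carrier G" for A B
    proof -
      have "A \<inter> B \<in> uf_translate G g p \<longleftrightarrow> A \<in> uf_translate G g p \<and> B \<in> uf_translate G g p"
        if "g \<in> carrier G" for g
        using ultrafilter_onD[OF tr[OF that]] \<open>A \<subseteq> carrier G\<close> \<open>B \<subseteq> carrier G\<close>
        by (meson Int_lower1 Int_lower2)
      then show ?thesis by blast
    qed
    show "?v (carrier G - A) = carrier G - ?v A" if "A \<subseteq> carrier G" for A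
      using ultrafilter_on_Diff_iff[OF tr that] by blast
  qed
  ultimately show ?thesis by simp
qed

lemma uf_translate_one:
  assumes "ultrafilter_on (carrier G) p"
  shows "uf_translate G \<one> p = p"
proof -
  have "{x \<in> carrier G. \<one> \<otimes> x \<in> A} = A" if "A \<subseteq> carrier G" for A
    using that by auto
  then show ?thesis
    using ultrafilter_on_subset[OF assms] by (auto simp: uf_translate_iff)
qed

lemma uf_translate_translate:
  assumes "g \<in> carrier G" "h \<in> carrier G"
  shows "uf_translate G h (uf_translate G g p) = uf_translate G (h \<otimes> g) p"
proof -
  have "{x \<in> carrier G. g \<otimes> x \<in> {y \<in> carrier G. h \<otimes> y \<in> A}} =
      {x \<in> carrier G. h \<otimes> g \<otimes> x \<in> A}" for A
    using assms by (auto simp: m_assoc)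
  then show ?thesis
    using assms by (auto simp: uf_translate_iff)
qed

lemma uf_translate_free:
  assumes g: "g \<in> carrier G" and p: "p \<in> free_ufs G"
  shows "uf_translate G g p \<in> free_ufs G"
proof -
  have "{y \<in> carrier G. g \<otimes> y \<in> {x}} = {inv g \<otimes> x}" if "x \<in> carrier G" for x
  proof -
    have "g \<otimes> y = x \<longleftrightarrow> y = inv g \<otimes> x" if "y \<in> carrier G" for y
      using inv_solve_left[of y g x] that g \<open>x \<in> carrier G\<close> by auto
    then show ?thesis
      using that g by auto
  qed
  then show ?thesis
    using g p ultrafilter_on_translate[OF g] by (auto simp: free_ufs_iff uf_translate_iff)
qed

lemma uf_orbit_eq_translate:
  assumes "q \<in> uf_orbit G p" "q' \<in> uf_orbit G p"
  obtains h where "h \<in> carrier G" "q' = uf_translate G h q"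
proof -
  obtain g g' where g: "g \<in> carrier G" "q = uf_translate G g p"
    and g': "g' \<in> carrier G" "q' = uf_translate G g' p"
    using assms by (auto simp: uf_orbit_def)
  have "uf_translate G (g' \<otimes> inv g) q = q'"
    using g g' by (simp add: uf_translate_translate m_assoc)
  with g g' that show thesis by (metis inv_closed m_closed)
qed

text \<open>Split \<open>G\<close> into the three sets \<open>B\<close>, \<open>g\<inverse>B\<close> and \<open>gB\<close>, where \<open>B\<close> is disjoint from \<open>gB\<close>. If
  \<open>gp = p\<close>, then \<open>p\<close> contains all three translates of \<open>B\<close> as soon as it contains one, which is
  impossible.\<close>

lemma uf_translate_neq:
  assumes p: "ultrafilter_on (carrier G) p" and g: "g \<in> carrier G" "g \<noteq> \<one>"
  shows "uf_translate G g p \<noteq> p"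
proof
  assume fixed: "uf_translate G g p = p"
  obtain B where B: "B \<subseteq> carrier G" "B \<inter> (\<otimes>) g ` B = {}"
    and cover: "\<And>x. x \<in> carrier G \<Longrightarrow> x \<in> B \<or> g \<otimes> x \<in> B \<or> x \<in> (\<otimes>) g ` B"
    using fixed_point_free_decomposition[of "carrier G" "(\<otimes>) g"] g by auto
  let ?gB = "(\<otimes>) g ` B" and ?hB = "{x \<in> carrier G. g \<otimes> x \<in> B}"
  have gB_sub: "?gB \<subseteq> carrier G"
    using B(1) g by auto
  have "{x \<in> carrier G. g \<otimes> x \<in> ?gB} = B"
    using B(1) g by (auto simp: subset_iff)
  then have gB: "?gB \<in> p \<longleftrightarrow> B \<in> p"
    using fixed gB_sub uf_translate_iff[OF g(1), of ?gB p] by simp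
  have hB: "?hB \<in> p \<longleftrightarrow> B \<in> p"
    using fixed B(1) uf_translate_iff[OF g(1), of B p] by simp
  have "B \<notin> p"
    using gB B(2) ultrafilter_onD[OF p] by metis
  then have "carrier G - B \<in> p" "carrier G - ?gB \<in> p" "carrier G - ?hB \<in> p"
    using gB hB B(1) gB_sub ultrafilter_on_Diff_iff[OF p] by auto
  then have "(carrier G - B) \<inter> ((carrier G - ?gB) \<inter> (carrier G - ?hB)) \<in> p"
    using ultrafilter_on_Int[OF p] by blast
  moreover have "(carrier G - B) \<inter> ((carrier G - ?gB) \<inter> (carrier G - ?hB)) = {}"
    using cover by auto
  ultimately show False
    using ultrafilter_on_empty[OF p] by simp
qed

end

section \<open>Recurrence and accumulation in companions\<close>

lemma discrete_in_beta_iff: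
  assumes "D \<subseteq> beta G"
  shows "subtopology (beta_topology G) D = discrete_topology D \<longleftrightarrow>
    (\<forall>q\<in>D. \<exists>U\<in>q. \<forall>q'\<in>D. U \<in> q' \<longrightarrow> q' = q)"
proof -
  have iso: "q \<notin> beta_topology G derived_set_of D \<longleftrightarrow> (\<exists>U\<in>q. \<forall>q'\<in>D. U \<in> q' \<longrightarrow> q' = q)"
    if q: "q \<in> D" for q
  proof
    assume "q \<notin> beta_topology G derived_set_of D"
    then obtain T where T: "q \<in> T" "openin (beta_topology G) T" "\<And>q'. q' \<in> D \<Longrightarrow> q' \<in> T \<Longrightarrow> q' = q"
      using q assms by (auto simp: in_derived_set_of topspace_beta_topology)
    obtain U where "U \<subseteq> carrier G" "q \<in> beta_basic G U" "beta_basic G U \<subseteq> T"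
      using T(1,2) unfolding openin_beta_topology_iff by blast
    then have "U \<in> q" "\<And>q'. q' \<in> D \<Longrightarrow> U \<in> q' \<Longrightarrow> q' = q"
      using T(3) assms unfolding beta_basic_def by blast+
    then show "\<exists>U\<in>q. \<forall>q'\<in>D. U \<in> q' \<longrightarrow> q' = q"
      by blast
  next
    assume "\<exists>U\<in>q. \<forall>q'\<in>D. U \<in> q' \<longrightarrow> q' = q"
    then obtain U where U: "U \<in> q" "\<And>q'. q' \<in> D \<Longrightarrow> U \<in> q' \<Longrightarrow> q' = q"
      by blast
    have "q \<in> beta G"
      using q assms by blast
    then have "q \<in> beta_basic G U" "openin (beta_topology G) (beta_basic G U)"
      using U(1) unfolding openin_beta_topology_iff
      by (auto simp: beta_basic_def beta_def dest: ultrafilter_on_subset)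
    moreover have "q' \<notin> beta_basic G U" if "q' \<in> D" "q' \<noteq> q" for q'
      using that U(2) by (auto simp: beta_basic_def)
    ultimately show "q \<notin> beta_topology G derived_set_of D"
      by (auto simp: in_derived_set_of)
  qed
  have "subtopology (beta_topology G) D = discrete_topology D \<longleftrightarrow>
      (\<forall>q\<in>D. q \<notin> beta_topology G derived_set_of D)"
    using assms by (simp add: subtopology_eq_discrete_topology_eq topspace_beta_topology
        disjoint_iff Ball_def)
  also have "\<dots> \<longleftrightarrow> (\<forall>q\<in>D. \<exists>U\<in>q. \<forall>q'\<in>D. U \<in> q' \<longrightarrow> q' = q)"
    by (rule ball_cong[OF refl iso])
  finally show ?thesis .
qed

context group
begin

text \<open>A free \<open>q\<close> contains no \<open>{\<one>}\<close>, so the \<open>q\<close>-many \<open>h\<close> that return \<open>p\<close> to \<open>A \<inter> U\<close> include one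
  other than \<open>\<one>\<close>.\<close>

lemma free_return_imp_translate_near:
  assumes p: "p \<in> star G A" and pq: "p \<in> free_orbit G p" and U: "U \<in> p"
  obtains q' where "q' \<in> companion G p A" "U \<in> q'" "q' \<noteq> p"
proof -
  have pf: "p \<in> free_ufs G" and pu: "ultrafilter_on (carrier G) p" and A: "A \<in> p"
    using p by (auto simp: star_def beta_basic_def beta_def)
  obtain q where q: "q \<in> free_ufs G" "p = uf_prod G q p"
    using pq by (auto simp: free_orbit_def)
  let ?S = "{h \<in> carrier G. A \<inter> U \<in> uf_translate G h p}"
  have qu: "ultrafilter_on (carrier G) q"
    using q(1) by (simp add: free_ufs_iff)
  have "A \<inter> U \<in> uf_prod G q p"
    using q(2) ultrafilter_on_Int[OF pu A U] by simp
  then have S: "?S \<in> q"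
    unfolding uf_prod_iff[of _ q] by (rule conjunct2)
  have "{\<one>} \<notin> q"
    using q(1) by (simp add: free_ufs_iff)
  then have "\<not> ?S \<subseteq> {\<one>}"
    using ultrafilter_on_mono[OF qu S, of "{\<one>}"] by auto
  then obtain h where h: "h \<in> carrier G" "A \<inter> U \<in> uf_translate G h p" "h \<noteq> \<one>"
    by blast
  note hpu = ultrafilter_on_translate[OF h(1) pu]
  have "A \<in> uf_translate G h p" "U \<in> uf_translate G h p"
    using ultrafilter_on_mono[OF hpu h(2)] ultrafilter_on_subset[OF pu] A U by auto
  moreover have "uf_translate G h p \<in> uf_orbit G p"
    using h(1) by (auto simp: uf_orbit_def)
  ultimately show thesis
    using that[of "uf_translate G h p"] uf_translate_free[OF h(1) pf] hpu
      uf_translate_neq[OF pu h(1,3)]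
    by (auto simp: companion_def star_def beta_basic_def beta_def)
qed

text \<open>The return sets of the neighbourhoods of \<open>q\<close> generate a filter along which \<open>hq\<close> converges to
  \<open>q\<close>. Leaving the stabiliser of \<open>q\<close> out of them is what makes every ultrafilter above it free.\<close>

lemma accumulated_imp_free_return:
  assumes q: "ultrafilter_on (carrier G) q"
    and acc: "\<And>U. U \<in> q \<Longrightarrow> \<exists>h \<in> carrier G. U \<in> uf_translate G h q \<and> uf_translate G h q \<noteq> q"
  shows "q \<in> free_orbit G q"
proof -
  define R where
    "R U = {h \<in> carrier G. U \<in> uf_translate G h q \<and> uf_translate G h q \<noteq> q}" for U
  note tr = ultrafilter_onD[OF ultrafilter_on_translate[OF _ q]]
  have R_Int: "R U \<inter> R V = R (U \<inter> V)" if "U \<in> q" "V \<in> q" for U V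
    using that tr(4) tr(5)[of _ "U \<inter> V"] ultrafilter_on_subset[OF q] unfolding R_def by blast
  obtain r where r: "ultrafilter_on (carrier G) r" "R ` q \<subseteq> r"
  proof (rule ultrafilter_on_extending)
    show "R ` q \<subseteq> Pow (carrier G)"
      by (auto simp: R_def)
    show "{} \<notin> R ` q"
      using acc by (fastforce simp: R_def)
    show "R ` q \<noteq> {}"
      using ultrafilter_on_UNIV[OF q] by blast
    show "S \<inter> T \<in> R ` q" if "S \<in> R ` q" "T \<in> R ` q" for S T
      using that R_Int ultrafilter_on_Int[OF q] by blast
  qed
  have "U \<in> uf_prod G r q" if "U \<in> q" for U
  proof -
    have "R U \<in> r"
      using that r(2) by blast
    moreover have "R U \<subseteq> {h \<in> carrier G. U \<in> uf_translate G h q}"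
      by (auto simp: R_def)
    ultimately have "{h \<in> carrier G. U \<in> uf_translate G h q} \<in> r"
      using ultrafilter_on_mono[OF r(1)] by blast
    with ultrafilter_on_subset[OF q that] show ?thesis
      unfolding uf_prod_iff[of _ r] by (rule conjI)
  qed
  then have eq: "q = uf_prod G r q"
    using ultrafilter_on_subset_eq[OF q ultrafilter_on_uf_prod[OF r(1) q]] by blast
  have "{h} \<notin> r" if "h \<in> carrier G" for h
  proof
    assume "{h} \<in> r"
    then have princ: "r = principal_uf (carrier G) h"
      by (rule principal_if_singleton_mem[OF r(1)])
    have "R (carrier G) \<in> r"
      using r(2) ultrafilter_on_UNIV[OF q] by blast
    then have "uf_translate G h q \<noteq> q"
      by (auto simp: princ principal_uf_def[of _ h] R_def)
    with eq princ show False by simp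
  qed
  with r(1) have "r \<in> free_ufs G"
    by (simp add: free_ufs_iff)
  with eq show ?thesis
    by (auto simp: free_orbit_def)
qed

end

theorem proposition8:
  fixes G :: "('a, 'm) monoid_scheme" and A :: "'a set"
  assumes "group G" and "A \<subseteq> carrier G"
  shows "disparse G A \<longleftrightarrow> (\<forall>p \<in> star G A. p \<notin> free_orbit G p)"
proof -
  interpret group G by fact
  have disparse: "disparse G A \<longleftrightarrow>
    (\<forall>p \<in> free_ufs G. \<forall>q \<in> companion G p A. \<exists>U\<in>q. \<forall>q'\<in>companion G p A. U \<in> q' \<longrightarrow> q' = q)"
  proof -
    have "companion G p A \<subseteq> beta G" for p
      by (auto simp: companion_def star_def beta_basic_def)
    then show ?thesis
      by (simp add: disparse_def discrete_in_beta_iff)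
  qed
  show ?thesis
  proof
    assume D: "disparse G A"
    show "\<forall>p \<in> star G A. p \<notin> free_orbit G p"
    proof (intro ballI notI)
      fix p assume p: "p \<in> star G A" and ret: "p \<in> free_orbit G p"
      then have pf: "p \<in> free_ufs G" and pu: "ultrafilter_on (carrier G) p"
        by (auto simp: star_def beta_basic_def beta_def)
      have "p \<in> uf_orbit G p"
        unfolding uf_orbit_def using uf_translate_one[OF pu] by (metis imageI one_closed)
      with p have "p \<in> companion G p A"
        by (simp add: companion_def)
      then have "\<exists>U\<in>p. \<forall>q'\<in>companion G p A. U \<in> q' \<longrightarrow> q' = p"
        by (rule D[unfolded disparse, THEN bspec, THEN bspec, OF pf])
      then obtain U where U: "U \<in> p" "\<forall>q'\<in>companion G p A. U \<in> q' \<longrightarrow> q' = p"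
        by (rule bexE)
      obtain q' where "q' \<in> companion G p A" "U \<in> q'" "q' \<noteq> p"
        by (rule free_return_imp_translate_near[OF p ret U(1)])
      with U(2) show False
        by simp
    qed
  next
    assume no_return: "\<forall>p \<in> star G A. p \<notin> free_orbit G p"
    show "disparse G A"
      unfolding disparse
    proof (intro ballI, rule ccontr)
      fix p q assume q: "q \<in> companion G p A"
        and not_isolated: "\<not> (\<exists>U\<in>q. \<forall>q'\<in>companion G p A. U \<in> q' \<longrightarrow> q' = q)"
      have "q \<in> free_orbit G q"
      proof (rule accumulated_imp_free_return)
        show "ultrafilter_on (carrier G) q"
          using q by (simp add: companion_def star_def beta_basic_def beta_def)
        fix U assume "U \<in> q"
        then obtain q' where q': "q' \<in> companion G p A" "U \<in> q'" "q' \<noteq> q"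
          using not_isolated by blast
        then obtain h where "h \<in> carrier G" "q' = uf_translate G h q"
          using q uf_orbit_eq_translate[of q p q'] by (auto simp: companion_def)
        with q' show "\<exists>h \<in> carrier G. U \<in> uf_translate G h q \<and> uf_translate G h q \<noteq> q"
          by blast
      qed
      with no_return q show False
        by (simp add: companion_def)
    qed
  qed
qed

end
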